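(* Suppose $A$ is a strong independence algebra of finite dimension $n$. (i) The partial endomorphism monoid $\operatorname{PEnd}(A)$ has a twisting given by $$\Phi(a,b)=n-\operatorname{rank}(a)-\operatorname{rank}(b)+\operatorname{rank}(ab).$$ (ii) For any $a,b\in\operatorname{PEnd}(A)$ we have $ab=ab'$ for some $b'\in\operatorname{PEnd}(A)$ with $\Phi(a,b')=0$. (iii) In part (ii), if $b$ belongs to $\operatorname{End}(A)$ or to $\operatorname{PAut}(A)$, then such an element $b'$ exists in $\operatorname{End}(A)$ or $\operatorname{PAut}(A)$, respectively.
   Context: A twisting of a monoid $S$ is a map $\Phi:S\times S\to\mathbb N=\{0,1,2,\dots\}$ with $\Phi(a,b)+\Phi(ab,c)=\Phi(a,bc)+\Phi(b,c)$ for all $a,b,c\in S$. Let $A$ be an algebra in the sense of universal algebra. $\langle X\rangle$ is the subalgebra generated by $X\subseteq A$ (the empty set counts as a subalgebra if $A$ has no constants). $X$ is independent if $x\notin\langle X\setminus\{x\}\rangle$ for all $x\in X$; a basis is an independent generating set. $A$ is an independence algebra if (E) for all $X\subseteq A$ and $x,y\in A$, $x\in\langle X\cup\{y\}\rangle\setminus\langle X\rangle$ implies $y\in\langle X\cup\{x\}\rangle$; and (F) if $X$ is a basis of $A$ then any map $X\to A$ extends to an endomorphism of $A$. In an independence algebra every independent set extends to a basis, and all bases have the same size, the dimension $\dim(A)$; subalgebras of independence algebras are independence algebras. $A$ is strong if: whenever $B,C\leq A$ are subalgebras and a basis $X$ of $B\cap C$ is extended to bases $X\sqcup Y$ of $B$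 and $X\sqcup Z$ of $C$, then $X\sqcup Y\sqcup Z$ is a basis of $B\vee C=\langle B\cup C\rangle$. A partial endomorphism of $A$ is a morphism $B\to A$ with $B\leq A$ a subalgebra. $\operatorname{PEnd}(A)$ is the monoid of all partial endomorphisms under composition of partial maps, where $ab$ means first $a$, then $b$ (maps written on the right); $\operatorname{End}(A)$ is the submonoid of endomorphisms (defined on all of $A$) and $\operatorname{PAut}(A)$ the submonoid of injective partial endomorphisms. $\operatorname{rank}(a)=\dim(\operatorname{im}(a))$. *)

theory Defs
  imports "HOL-Algebra.Group" "HOL.Hull"
begin

text \<open>Only the function symbols in \<open>symbols\<close> count; in particular this set may be empty.
  The carrier may be empty as well (then there are no constants).\<close>

record ('a, 'f) ualgebra = "'a partial_object" +
  symbols :: "'f set"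
  arity :: "'f \<Rightarrow> nat"
  interp :: "'f \<Rightarrow> 'a list \<Rightarrow> 'a"

definition subalgebra :: "('a, 'f) ualgebra \<Rightarrow> 'a set \<Rightarrow> bool" where
  "subalgebra A B \<longleftrightarrow> B \<subseteq> carrier A \<and>
    (\<forall>f\<in>symbols A. \<forall>xs. length xs = arity A f \<longrightarrow> set xs \<subseteq> B \<longrightarrow> interp A f xs \<in> B)"

definition generated :: "('a, 'f) ualgebra \<Rightarrow> 'a set \<Rightarrow> 'a set" where
  "generated A X = subalgebra A hull X"

definition independent :: "('a, 'f) ualgebra \<Rightarrow> 'a set \<Rightarrow> bool" where
  "independent A X \<longleftrightarrow> X \<subseteq> carrier A \<and> (\<forall>x\<in>X. x \<notin> generated A (X - {x}))"

text \<open>\<open>basis A B X\<close>: \<open>X\<close> is a basis of the subalgebra \<open>B\<close> of \<open>A\<close>. A subset of \<open>B\<close> generates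
  the same subalgebra in \<open>B\<close> as in \<open>A\<close>, so independence in \<open>B\<close> and in \<open>A\<close> agree.\<close>

definition basis :: "('a, 'f) ualgebra \<Rightarrow> 'a set \<Rightarrow> 'a set \<Rightarrow> bool" where
  "basis A B X \<longleftrightarrow> independent A X \<and> generated A X = B"

text \<open>Meaningful for subalgebras \<open>B\<close> of an independence algebra, where all bases have the same
  size; since \<open>card\<close> is \<open>0\<close> on infinite sets, finite dimension is a separate predicate.\<close>

definition dimension :: "('a, 'f) ualgebra \<Rightarrow> 'a set \<Rightarrow> nat" where
  "dimension A B = card (SOME X. basis A B X)"

definition finite_dimensional :: "('a, 'f) ualgebra \<Rightarrow> bool" where
  "finite_dimensional A \<longleftrightarrow> (\<exists>X. basis A (carrier A) X \<and> finite X)"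

definition partial_endo :: "('a, 'f) ualgebra \<Rightarrow> ('a \<rightharpoonup> 'a) \<Rightarrow> bool" where
  "partial_endo A b \<longleftrightarrow> subalgebra A (dom b) \<and> ran b \<subseteq> carrier A \<and>
    (\<forall>f\<in>symbols A. \<forall>xs. length xs = arity A f \<longrightarrow> set xs \<subseteq> dom b \<longrightarrow>
      b (interp A f xs) = Some (interp A f (map (the \<circ> b) xs)))"

text \<open>Maps act on the right: the product of \<open>a\<close> and \<open>b\<close> is first \<open>a\<close>, then \<open>b\<close>.\<close>

definition PEnd :: "('a, 'f) ualgebra \<Rightarrow> ('a \<rightharpoonup> 'a) monoid" where
  "PEnd A = \<lparr>carrier = {b. partial_endo A b},
             mult = (\<lambda>a b. b \<circ>\<^sub>m a),
             one = Some |` carrier A\<rparr>"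

definition End :: "('a, 'f) ualgebra \<Rightarrow> ('a \<rightharpoonup> 'a) set" where
  "End A = {b \<in> carrier (PEnd A). dom b = carrier A}"

definition PAut :: "('a, 'f) ualgebra \<Rightarrow> ('a \<rightharpoonup> 'a) set" where
  "PAut A = {b \<in> carrier (PEnd A). inj_on b (dom b)}"

definition rank :: "('a, 'f) ualgebra \<Rightarrow> ('a \<rightharpoonup> 'a) \<Rightarrow> nat" where
  "rank A a = dimension A (ran a)"

locale universal_algebra =
  fixes A :: "('a, 'f) ualgebra"
  assumes interp_closed: "\<lbrakk>f \<in> symbols A; length xs = arity A f; set xs \<subseteq> carrier A\<rbrakk>
    \<Longrightarrow> interp A f xs \<in> carrier A"

locale independence_algebra = universal_algebra +
  assumes exchange: "\<lbrakk>X \<subseteq> carrier A; x \<in> carrier A; y \<in> carrier A;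
      x \<in> generated A (X \<union> {y}) - generated A X\<rbrakk> \<Longrightarrow> y \<in> generated A (X \<union> {x})"
    and extension: "\<lbrakk>basis A (carrier A) X; g \<in> X \<rightarrow> carrier A\<rbrakk>
      \<Longrightarrow> \<exists>h\<in>End A. \<forall>x\<in>X. h x = Some (g x)"

text \<open>In the conclusion, \<open>Y\<close> and \<open>Z\<close> are automatically disjoint: a common element would lie in
  \<open>B \<inter> C\<close>, which is generated by \<open>X\<close>, against independence of \<open>X \<union> Y\<close>.\<close>

locale strong_independence_algebra = independence_algebra +
  assumes strong: "\<lbrakk>subalgebra A B; subalgebra A C; basis A (B \<inter> C) X;
      X \<inter> Y = {}; basis A B (X \<union> Y); X \<inter> Z = {}; basis A C (X \<union> Z)\<rbrakk>
    \<Longrightarrow> basis A (generated A (B \<union> C)) (X \<union> Y \<union> Z)"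

text \<open>Twistings take values in \<open>\<nat>\<close>, regarded as a subset of the integers so that the
  subtractions in formulas for them are not truncated.\<close>

locale twisting = monoid S for S (structure) +
  fixes \<Phi> :: "'a \<Rightarrow> 'a \<Rightarrow> int"
  assumes twisting_Nats: "\<lbrakk>a \<in> carrier S; b \<in> carrier S\<rbrakk> \<Longrightarrow> \<Phi> a b \<in> \<nat>"
    and twisting_eq: "\<lbrakk>a \<in> carrier S; b \<in> carrier S; c \<in> carrier S\<rbrakk>
      \<Longrightarrow> \<Phi> a b + \<Phi> (a \<otimes> b) c = \<Phi> a (b \<otimes> c) + \<Phi> b c"

end

theory Submission imports Defs
begin

text \<open>The cocycle identity for \<open>\<Phi>\<close> is immediate from associativity, so (i) amounts to
  \<open>\<Phi> \<ge> 0\<close>. Take a basis \<open>X\<close> of \<open>im a \<inter> dom b\<close> and extend it to bases \<open>X \<union> Y\<close> of \<open>im a\<close> and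
  \<open>X \<union> Z\<close> of \<open>dom b\<close>. Since \<open>A\<close> is strong, \<open>X \<union> Y \<union> Z\<close> is independent, so it has at most \<open>n\<close>
  elements, while \<open>rank b \<le> rank (ab) + |Z|\<close>.

  For (ii) and (iii), extend \<open>X \<union> Y\<close> to a basis \<open>X \<union> Y \<union> V\<close> of \<open>A\<close> and let \<open>b'\<close> have domain
  \<open>\<langle>X \<union> V\<rangle>\<close>, agree with \<open>b\<close> on \<open>X\<close>, and send \<open>V\<close> injectively to a set that is independent over
  \<open>\<langle>Xb\<rangle>\<close>. By independence \<open>\<langle>X \<union> Y\<rangle> \<inter> \<langle>X \<union> V\<rangle> = \<langle>X\<rangle>\<close>, hence \<open>ab' = ab\<close>. This one \<open>b'\<close> is total
  if \<open>b\<close> is (then \<open>Y = \<emptyset>\<close>) and injective if \<open>b\<close> is.\<close>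

section \<open>Generated subalgebras and partial endomorphisms\<close>

context universal_algebra
begin

section \<open>Closure under generation, and independence\<close>

lemma subalgebra_carrier: "subalgebra A (carrier A)"
  using interp_closed by (auto simp: subalgebra_def)

lemma subalgebra_Inter:
  assumes "\<And>B. B \<in> \<B> \<Longrightarrow> subalgebra A B" and "\<B> \<noteq> {}"
  shows "subalgebra A (\<Inter>\<B>)"
proof -
  have "\<Inter>\<B> \<subseteq> carrier A"
    using assms by (auto simp: subalgebra_def)
  moreover have "interp A f xs \<in> \<Inter>\<B>"
    if "f \<in> symbols A" "length xs = arity A f" "set xs \<subseteq> \<Inter>\<B>" for f xs
    using assms(1) that by (auto simp: subalgebra_def subset_iff)
  ultimately show ?thesis
    by (simp add: subalgebra_def)
qed

lemma subalgebra_Int: "subalgebra A B \<Longrightarrow> subalgebra A C \<Longrightarrow> subalgebra A (B \<inter> C)"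
  using subalgebra_Inter[of "{B, C}"] by auto

lemma subalgebra_subset: "subalgebra A B \<Longrightarrow> B \<subseteq> carrier A"
  by (simp add: subalgebra_def)

lemma subalgebra_generated:
  assumes "X \<subseteq> carrier A"
  shows "subalgebra A (generated A X)"
  unfolding generated_def hull_def using assms subalgebra_carrier
  by (intro subalgebra_Inter) auto

lemma generated_superset: "X \<subseteq> generated A X"
  by (simp add: generated_def hull_subset)

lemma generated_least: "X \<subseteq> B \<Longrightarrow> subalgebra A B \<Longrightarrow> generated A X \<subseteq> B"
  by (simp add: generated_def hull_minimal)

lemma generated_mono: "X \<subseteq> Y \<Longrightarrow> generated A X \<subseteq> generated A Y"
  by (simp add: generated_def hull_mono)

lemma generated_in_carrier: "X \<subseteq> carrier A \<Longrightarrow> generated A X \<subseteq> carrier A"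
  by (simp add: generated_least subalgebra_carrier)

lemma generated_subalgebra_eq: "subalgebra A B \<Longrightarrow> generated A B = B"
  by (simp add: generated_least generated_superset subset_antisym)

lemma generated_subset_iff:
  "Y \<subseteq> carrier A \<Longrightarrow> generated A X \<subseteq> generated A Y \<longleftrightarrow> X \<subseteq> generated A Y"
  using generated_least generated_superset subalgebra_generated by blast

text \<open>Used to thin a generating set to a basis while other generators are kept: each of the
  two unions lies in the closure of the other.\<close>

lemma generated_Un_cong:
  assumes "X \<subseteq> carrier A" "Y \<subseteq> carrier A" "Z \<subseteq> carrier A" "generated A X = generated A Y"
  shows "generated A (X \<union> Z) = generated A (Y \<union> Z)"
proof -
  have "X \<union> Z \<subseteq> generated A (Y \<union> Z)"
    using assms(4) generated_superset[of X] generated_superset[of "Y \<union> Z"]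
      generated_mono[of Y "Y \<union> Z"] by blast
  moreover have "Y \<union> Z \<subseteq> generated A (X \<union> Z)"
    using assms(4) generated_superset[of Y] generated_superset[of "X \<union> Z"]
      generated_mono[of X "X \<union> Z"] by blast
  ultimately show ?thesis
    using assms(1-3) by (intro subset_antisym) (simp_all add: generated_subset_iff)
qed

lemma independent_subset:
  assumes "independent A X" "Y \<subseteq> X"
  shows "independent A Y"
proof -
  have "generated A (Y - {y}) \<subseteq> generated A (X - {y})" for y
    using assms(2) by (intro generated_mono) blast
  with assms show ?thesis
    unfolding independent_def by blast
qed

text \<open>By disjointness, \<open>X\<close> survives the removal of any \<open>y \<in> Y\<close>,
  so such a \<open>y\<close> would be generated by the remaining elements. This serves to show that
  an extension of a basis is trivial.\<close>

lemma independent_Un_generated: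
  assumes "independent A (X \<union> Y)" "Y \<subseteq> generated A X" "X \<inter> Y = {}"
  shows "Y = {}"
proof (rule ccontr)
  assume "Y \<noteq> {}"
  then obtain y where y: "y \<in> Y" by blast
  then have "X \<subseteq> X \<union> Y - {y}"
    using assms(3) by blast
  then have "y \<in> generated A (X \<union> Y - {y})"
    using generated_mono[of X "X \<union> Y - {y}"] assms(2) y by blast
  with assms(1) y show False
    by (auto simp: independent_def)
qed

section \<open>Partial endomorphisms: images, preimages, restrictions\<close>

lemma partial_endo_dom: "partial_endo A b \<Longrightarrow> subalgebra A (dom b)"
  and partial_endo_ran: "partial_endo A b \<Longrightarrow> ran b \<subseteq> carrier A"
  by (auto simp: partial_endo_def)

lemma partial_endo_interp:
  assumes "partial_endo A b" "f \<in> symbols A" "length xs = arity A f" "set xs \<subseteq> dom b"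
  shows "b (interp A f xs) = Some (interp A f (map (the \<circ> b) xs))"
  using assms unfolding partial_endo_def by blast

lemma ran_eq_image: "ran b = (the \<circ> b) ` dom b"
  by (force simp: ran_def dom_def image_iff)

lemma ran_map_comp: "ran (b \<circ>\<^sub>m a) = (the \<circ> b) ` (ran a \<inter> dom b)"
  by (force simp: ran_def dom_def image_iff map_comp_Some_iff)

lemma partial_endo_image_subset:
  assumes "partial_endo A b" "X \<subseteq> dom b"
  shows "(the \<circ> b) ` X \<subseteq> carrier A"
  using partial_endo_ran[OF assms(1)] image_mono[OF assms(2), of "the \<circ> b"]
  unfolding ran_eq_image by (rule subset_trans[rotated])

lemma subalgebra_image:
  assumes b: "partial_endo A b" and B: "subalgebra A B" "B \<subseteq> dom b"
  shows "subalgebra A ((the \<circ> b) ` B)"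
  unfolding subalgebra_def
proof (intro conjI ballI allI impI)
  show "(the \<circ> b) ` B \<subseteq> carrier A"
    using partial_endo_image_subset b B(2) .
  fix f xs
  assume f: "f \<in> symbols A" and len: "length xs = arity A f" and xs: "set xs \<subseteq> (the \<circ> b) ` B"
  \<comment> \<open>Passing to \<open>lists\<close> yields preimages in \<open>B\<close> for all
    entries of \<open>xs\<close> at once.\<close>
  have "xs \<in> lists ((the \<circ> b) ` B)"
    using xs by auto
  then obtain ys where ys: "xs = map (the \<circ> b) ys" "set ys \<subseteq> B"
    unfolding lists_image by (auto simp: in_lists_conv_set)
  have "interp A f ys \<in> B"
    using B(1) f len ys by (simp add: subalgebra_def)
  moreover have "(the \<circ> b) (interp A f ys) = interp A f xs"
    using partial_endo_interp[OF b f] len ys B(2) by simp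
  ultimately show "interp A f xs \<in> (the \<circ> b) ` B"
    by (metis image_eqI)
qed

lemma subalgebra_preimage:
  assumes b: "partial_endo A b" and B: "subalgebra A B"
  shows "subalgebra A {x \<in> dom b. the (b x) \<in> B}"
proof -
  have "b (interp A f xs) = Some (interp A f (map (the \<circ> b) xs))
        \<and> interp A f (map (the \<circ> b) xs) \<in> B"
    if "f \<in> symbols A" "length xs = arity A f" "set xs \<subseteq> {x \<in> dom b. the (b x) \<in> B}" for f xs
  proof
    show "b (interp A f xs) = Some (interp A f (map (the \<circ> b) xs))"
      using that by (intro partial_endo_interp[OF b]) auto
    have "set (map (the \<circ> b) xs) \<subseteq> B"
      using that(3) by auto
    with B that(1,2) show "interp A f (map (the \<circ> b) xs) \<in> B"
      by (simp add: subalgebra_def)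
  qed
  then show ?thesis
    using partial_endo_dom[OF b] by (auto simp: subalgebra_def)
qed

lemma subalgebra_ran: "partial_endo A b \<Longrightarrow> subalgebra A (ran b)"
  unfolding ran_eq_image by (rule subalgebra_image) (simp_all add: partial_endo_dom)

text \<open>The preimage of the subalgebra generated by the image of \<open>X\<close> is a
  subalgebra containing \<open>X\<close>; conversely, the image of \<open>generated A X\<close> is a
  subalgebra containing the image of \<open>X\<close>.\<close>

lemma image_generated:
  assumes b: "partial_endo A b" and X: "X \<subseteq> dom b"
  shows "(the \<circ> b) ` generated A X = generated A ((the \<circ> b) ` X)"
proof
  have XA: "X \<subseteq> carrier A"
    using X partial_endo_dom[OF b] subalgebra_subset by blast
  have gX: "generated A X \<subseteq> dom b"
    using X partial_endo_dom[OF b] generated_least by blast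
  have bXA: "(the \<circ> b) ` X \<subseteq> carrier A"
    using partial_endo_image_subset[OF b X] .
  have "generated A X \<subseteq> {x \<in> dom b. the (b x) \<in> generated A ((the \<circ> b) ` X)}"
    using subalgebra_preimage[OF b subalgebra_generated[OF bXA]] X
      generated_superset[of "(the \<circ> b) ` X"]
    by (intro generated_least) auto
  then show "(the \<circ> b) ` generated A X \<subseteq> generated A ((the \<circ> b) ` X)"
    by auto
  show "generated A ((the \<circ> b) ` X) \<subseteq> (the \<circ> b) ` generated A X"
    using subalgebra_image[OF b subalgebra_generated[OF XA] gX] generated_superset
    by (intro generated_least image_mono)
qed

text \<open>The equalizer of \<open>b\<close> and \<open>c\<close> inside \<open>dom b\<close> is a
  subalgebra. Equality of options there also places its elements in \<open>dom c\<close>.\<close>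

lemma partial_endos_agree:
  assumes b: "partial_endo A b" and c: "partial_endo A c"
    and X: "X \<subseteq> dom b" "\<And>x. x \<in> X \<Longrightarrow> b x = c x" and y: "y \<in> generated A X"
  shows "b y = c y"
proof -
  have "interp A f xs \<in> {x \<in> dom b. b x = c x}"
    if f: "f \<in> symbols A" "length xs = arity A f" and xs: "set xs \<subseteq> {x \<in> dom b. b x = c x}" for f xs
  proof -
    have xb: "set xs \<subseteq> dom b" and bc: "\<And>x. x \<in> set xs \<Longrightarrow> b x = c x"
      using xs by auto
    then have xc: "set xs \<subseteq> dom c" and m: "map (the \<circ> b) xs = map (the \<circ> c) xs"
      by (auto simp: domIff subset_iff)
    show ?thesis
      using partial_endo_interp[OF b f xb] partial_endo_interp[OF c f xc] unfolding m by auto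
  qed
  then have "subalgebra A {x \<in> dom b. b x = c x}"
    using partial_endo_dom[OF b] by (auto simp: subalgebra_def)
  then have "generated A X \<subseteq> {x \<in> dom b. b x = c x}"
    using X by (intro generated_least) auto
  with y show ?thesis by auto
qed

lemma partial_endo_restrict:
  assumes b: "partial_endo A b" and B: "subalgebra A B" "B \<subseteq> dom b"
  shows "partial_endo A (b |` B)"
proof -
  have dom: "dom (b |` B) = B"
    using B(2) by auto
  have "(b |` B) (interp A f xs) = Some (interp A f (map (the \<circ> (b |` B)) xs))"
    if f: "f \<in> symbols A" "length xs = arity A f" and xs: "set xs \<subseteq> B" for f xs
  proof -
    have "interp A f xs \<in> B"
      using B(1) f xs by (simp add: subalgebra_def)
    moreover have "map (the \<circ> (b |` B)) xs = map (the \<circ> b) xs"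
      using xs by auto
    moreover have "b (interp A f xs) = Some (interp A f (map (the \<circ> b) xs))"
      using xs B(2) by (intro partial_endo_interp[OF b f]) auto
    ultimately show ?thesis
      by (simp only: restrict_in)
  qed
  moreover have "ran (b |` B) \<subseteq> carrier A"
    using partial_endo_ran[OF b] by (auto simp: ran_def restrict_map_def split: if_splits)
  ultimately show ?thesis
    using B(1) dom by (simp add: partial_endo_def)
qed

section \<open>The monoid of partial endomorphisms, and images under its injective elements\<close>

lemma partial_endo_id: "partial_endo A (Some |` carrier A)"
proof -
  have "map (the \<circ> (Some |` carrier A)) xs = xs" if "set xs \<subseteq> carrier A" for xs
    using that by (intro map_idI) auto
  moreover have "dom (Some |` carrier A) = carrier A" "ran (Some |` carrier A) = carrier A"
    by (auto simp: ran_def restrict_map_def split: if_splits)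
  ultimately show ?thesis
    using subalgebra_carrier interp_closed by (simp add: partial_endo_def)
qed

lemma partial_endo_comp:
  assumes a: "partial_endo A a" and b: "partial_endo A b"
  shows "partial_endo A (b \<circ>\<^sub>m a)"
proof -
  have dom: "dom (b \<circ>\<^sub>m a) = {x \<in> dom a. the (a x) \<in> dom b}"
    by (force simp: dom_def map_comp_def split: option.splits)
  have "(b \<circ>\<^sub>m a) (interp A f xs) = Some (interp A f (map (the \<circ> (b \<circ>\<^sub>m a)) xs))"
    if f: "f \<in> symbols A" "length xs = arity A f"
      and xs: "set xs \<subseteq> {x \<in> dom a. the (a x) \<in> dom b}" for f xs
  proof -
    have 1: "a (interp A f xs) = Some (interp A f (map (the \<circ> a) xs))"
      using xs by (intro partial_endo_interp[OF a f]) auto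
    have 2: "b (interp A f (map (the \<circ> a) xs)) = Some (interp A f (map (the \<circ> b) (map (the \<circ> a) xs)))"
      using xs f(2) by (intro partial_endo_interp[OF b f(1)]) auto
    have 3: "map (the \<circ> b) (map (the \<circ> a) xs) = map (the \<circ> (b \<circ>\<^sub>m a)) xs"
      using xs by (auto simp: map_comp_def split: option.splits)
    show ?thesis
      using 1 2 unfolding 3 by (simp add: map_comp_def)
  qed
  moreover have "ran (b \<circ>\<^sub>m a) \<subseteq> carrier A"
    using partial_endo_ran[OF b] by (auto simp: ran_def map_comp_Some_iff)
  ultimately show ?thesis
    using subalgebra_preimage[OF a partial_endo_dom[OF b]] by (simp add: partial_endo_def dom)
qed

lemma map_comp_restrict_id:
  assumes "partial_endo A a"
  shows "a \<circ>\<^sub>m (Some |` carrier A) = a" and "(Some |` carrier A) \<circ>\<^sub>m a = a"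
proof -
  have d: "dom a \<subseteq> carrier A" and r: "ran a \<subseteq> carrier A"
    using assms partial_endo_dom subalgebra_subset partial_endo_ran by blast+
  show "a \<circ>\<^sub>m (Some |` carrier A) = a"
  proof
    show "(a \<circ>\<^sub>m (Some |` carrier A)) x = a x" for x
      using d by (cases "a x") (auto simp: map_comp_def restrict_map_def)
  qed
  show "(Some |` carrier A) \<circ>\<^sub>m a = a"
  proof
    show "((Some |` carrier A) \<circ>\<^sub>m a) x = a x" for x
      using r by (cases "a x") (auto simp: map_comp_def restrict_map_def ran_def)
  qed
qed

lemma monoid_PEnd: "monoid (PEnd A)"
proof (rule monoidI)
  show "a \<otimes>\<^bsub>PEnd A\<^esub> b \<otimes>\<^bsub>PEnd A\<^esub> c = a \<otimes>\<^bsub>PEnd A\<^esub> (b \<otimes>\<^bsub>PEnd A\<^esub> c)" for a b c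
    by (auto simp: PEnd_def map_comp_def fun_eq_iff split: option.splits)
qed (auto simp: PEnd_def partial_endo_id partial_endo_comp map_comp_restrict_id)

text \<open>If the image of \<open>x\<close> were generated by the other images,
  \<open>image_generated\<close> would give a \<open>y\<close> generated by \<open>X - {x}\<close>
  with the same image, and injectivity would force \<open>y = x\<close>.\<close>

lemma independent_image:
  assumes b: "partial_endo A b" and inj: "inj_on (the \<circ> b) (dom b)"
    and X: "independent A X" "X \<subseteq> dom b"
  shows "independent A ((the \<circ> b) ` X)"
  unfolding independent_def
proof (intro conjI ballI notI)
  show "(the \<circ> b) ` X \<subseteq> carrier A"
    using partial_endo_image_subset[OF b X(2)] .
  fix z
  assume "z \<in> (the \<circ> b) ` X" and z: "z \<in> generated A ((the \<circ> b) ` X - {z})"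
  then obtain x where x: "x \<in> X" "z = (the \<circ> b) x"
    by blast
  have "(the \<circ> b) ` X - {z} \<subseteq> (the \<circ> b) ` (X - {x})"
    using x by blast
  with z have "z \<in> (the \<circ> b) ` generated A (X - {x})"
    using image_generated[OF b, of "X - {x}"] X(2) generated_mono by blast
  then obtain y where y: "y \<in> generated A (X - {x})" "z = (the \<circ> b) y"
    by blast
  have "y \<in> dom b"
    using y(1) X(2) generated_least[of "X - {x}" "dom b"] partial_endo_dom[OF b] by blast
  moreover have "(the \<circ> b) x = (the \<circ> b) y"
    using x(2) y(2) by simp
  ultimately have "x = y"
    using inj x(1) X(2) by (meson inj_onD subsetD)
  with y(1) have "x \<in> generated A (X - {x})" by simp
  with x(1) X(1) show False
    unfolding independent_def by blast
qed

end

text \<open>Links the form of injectivity in \<open>PAut\<close> to the total function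
  \<open>the \<circ> b\<close>, through which images are written.\<close>

lemma inj_on_the: "inj_on (the \<circ> b) (dom b) \<longleftrightarrow> inj_on b (dom b)"
  unfolding inj_on_def by (metis comp_apply domIff option.expand)

section \<open>Bases and dimension\<close>

context independence_algebra
begin

text \<open>If an old element \<open>x\<close> came to depend on \<open>y\<close> and the rest of
  \<open>X\<close>, exchange would put \<open>y\<close> into the closure of
  \<open>X\<close>.\<close>

lemma independent_insert:
  assumes X: "independent A X" and y: "y \<in> carrier A" "y \<notin> generated A X"
  shows "independent A (insert y X)"
  unfolding independent_def
proof (intro conjI ballI notI)
  have XA: "X \<subseteq> carrier A"
    using X by (simp add: independent_def)
  then show "insert y X \<subseteq> carrier A"
    using y by simp
  fix x
  assume x: "x \<in> insert y X" and gen: "x \<in> generated A (insert y X - {x})"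
  have "y \<notin> X"
    using y(2) generated_superset[of X] by blast
  show False
  proof (cases "x = y")
    case True
    with gen \<open>y \<notin> X\<close> y(2) show False by simp
  next
    case False
    with x have "x \<in> X" by simp
    moreover have "insert y X - {x} = (X - {x}) \<union> {y}"
      using False by blast
    ultimately have "y \<in> generated A ((X - {x}) \<union> {x})"
      using exchange[of "X - {x}" x y] gen X XA y(1) by (auto simp: independent_def)
    with y(2) \<open>x \<in> X\<close> show False
      by (simp add: insert_absorb)
  qed
qed

text \<open>Steinitz replacement: an element of \<open>I\<close> outside \<open>G\<close> is traded
  for one of \<open>G\<close>, which keeps \<open>card I\<close> and independence and shrinks
  \<open>I - G\<close>.\<close>

lemma card_independent_le:
  assumes "independent A I" "finite I" "G \<subseteq> carrier A" "finite G" "I \<subseteq> generated A G"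
  shows "card I \<le> card G"
  using assms(1,2,5)
proof (induction "card (I - G)" arbitrary: I rule: less_induct)
  case less
  show ?case
  proof (cases "I \<subseteq> G")
    case True
    then show ?thesis
      by (simp add: card_mono assms(4))
  next
    case False
    then obtain x where x: "x \<in> I" "x \<notin> G" by blast
    have IA: "I - {x} \<subseteq> carrier A"
      using less.prems(1) by (auto simp: independent_def)
    have xn: "x \<notin> generated A (I - {x})"
      using less.prems(1) x by (auto simp: independent_def)
    \<comment> \<open>Otherwise \<open>I - {x}\<close> would generate everything that
      \<open>G\<close> generates, in particular \<open>x\<close>.\<close>
    have "\<not> G \<subseteq> generated A (I - {x})"
      using xn x(1) less.prems(3) generated_subset_iff[OF IA] by blast
    then obtain g where g: "g \<in> G" "g \<notin> generated A (I - {x})" by blast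
    let ?J = "insert g (I - {x})"
    have gI: "g \<notin> I - {x}"
      using g(2) generated_superset[of "I - {x}"] by blast
    have "independent A ?J"
      using less.prems(1) g assms(3) by (intro independent_insert) (auto intro: independent_subset)
    moreover have "?J \<subseteq> generated A G"
      using less.prems(3) g(1) generated_superset[of G] by blast
    moreover have "card (?J - G) < card (I - G)"
      using x g(1) less.prems(2) by (intro psubset_card_mono) auto
    ultimately have "card ?J \<le> card G"
      using less.hyps less.prems(2) by blast
    moreover have "card ?J = card I"
      using gI x(1) less.prems(2) by (metis card.insert card_Suc_Diff1 finite_Diff)
    ultimately show ?thesis by simp
  qed
qed

text \<open>Elements of \<open>Y\<close> are removed one at a time. If \<open>v\<close> needed
  \<open>y\<close>, exchange would express \<open>y\<close> through \<open>v\<close> and the other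
  generators, hence through the rest of the independent set.\<close>

lemma generated_Int_independent:
  assumes "finite Y" "independent A (X \<union> Y \<union> V)" "Y \<inter> (X \<union> V) = {}"
  shows "generated A (X \<union> Y) \<inter> generated A (X \<union> V) = generated A X"
proof
  show "generated A X \<subseteq> generated A (X \<union> Y) \<inter> generated A (X \<union> V)"
    by (simp add: generated_mono)
  have "v \<in> generated A X" if v: "v \<in> generated A (X \<union> V)" and "v \<in> generated A (X \<union> Y)" for v
    using assms that(2)
  proof (induction Y rule: finite_induct)
    case empty
    then show ?case by simp
  next
    case (insert y Y)
    have sub: "X \<union> insert y Y \<union> V \<subseteq> carrier A"
      using insert.prems(1) by (simp add: independent_def)
    have "v \<in> generated A (X \<union> Y)"
    proof (rule ccontr)
      assume "v \<notin> generated A (X \<union> Y)"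
      moreover have "v \<in> carrier A"
        using v sub generated_in_carrier[of "X \<union> V"] by blast
      ultimately have "y \<in> generated A ((X \<union> Y) \<union> {v})"
        using exchange[of "X \<union> Y" v y] sub insert.prems(3) by auto
      moreover have "(X \<union> Y) \<union> {v} \<subseteq> generated A (X \<union> Y \<union> V)"
        using v generated_mono[of "X \<union> V" "X \<union> Y \<union> V"] generated_superset[of "X \<union> Y \<union> V"] by blast
      ultimately have "y \<in> generated A (X \<union> Y \<union> V)"
        using generated_subset_iff[of "X \<union> Y \<union> V" "(X \<union> Y) \<union> {v}"] sub by blast
      moreover have "X \<union> Y \<union> V = X \<union> insert y Y \<union> V - {y}"
        using insert.hyps(2) insert.prems(2) by blast
      ultimately have "y \<in> generated A (X \<union> insert y Y \<union> V - {y})"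
        by (rule back_subst[where P = "\<lambda>S. y \<in> generated A S"])
      then show False
        using insert.prems(1) unfolding independent_def by blast
    qed
    moreover have "independent A (X \<union> Y \<union> V)"
      using insert.prems(1) by (rule independent_subset) blast
    ultimately show ?case
      using insert.IH insert.prems(2) by blast
  qed
  then show "generated A (X \<union> Y) \<inter> generated A (X \<union> V) \<subseteq> generated A X"
    by blast
qed

end

section \<open>Finite dimension: existence and size of bases\<close>

locale finite_dimensional_independence_algebra = independence_algebra +
  assumes finite_dim: "finite_dimensional A"
begin

text \<open>An infinite independent set would contain an independent set with one element more than
  a finite basis.\<close>

lemma finite_independent:
  assumes "independent A I"
  shows "finite I"
proof (rule ccontr)
  assume "infinite I"
  obtain G where G: "basis A (carrier A) G" "finite G"
    using finite_dim by (auto simp: finite_dimensional_def)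
  obtain J where J: "J \<subseteq> I" "finite J" "card J = Suc (card G)"
    using infinite_arbitrarily_large[OF \<open>infinite I\<close>] by metis
  have "independent A J"
    using J(1) assms independent_subset by blast
  then have "card J \<le> card G"
    using G J(2) by (intro card_independent_le) (auto simp: basis_def independent_def)
  with J(3) show False by simp
qed

lemma card_bases_eq:
  assumes "basis A B X" "basis A B Y"
  shows "card X = card Y"
proof (rule antisym)
  show "card X \<le> card Y" "card Y \<le> card X"
    using assms generated_superset[of X] generated_superset[of Y]
    by (intro card_independent_le; force simp: basis_def independent_def finite_independent)+
qed

text \<open>Any basis may stand in for the one that \<open>SOME\<close> picks, since all have the
  same size.\<close>

lemma dimension_eq: "basis A B X \<Longrightarrow> dimension A B = card X"
  unfolding dimension_def using card_bases_eq by (meson someI)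

text \<open>An independent set of largest size between \<open>I\<close> and \<open>G\<close>
  generates \<open>G\<close>, since any element of \<open>G\<close> outside its closure could be
  added.\<close>

lemma ex_basis_between:
  assumes I: "independent A I" "I \<subseteq> G" and G: "G \<subseteq> carrier A"
  obtains X where "I \<subseteq> X" "X \<subseteq> G" "basis A (generated A G) X"
proof -
  obtain T where T: "basis A (carrier A) T" "finite T"
    using finite_dim by (auto simp: finite_dimensional_def)
  let ?P = "\<lambda>X. I \<subseteq> X \<and> X \<subseteq> G \<and> independent A X"
  \<comment> \<open>The existence of a maximum is obtained from a strict bound, hence the
    successor.\<close>
  have "card X < Suc (card T)" if "?P X" for X
    using that T finite_independent card_independent_le[of X T]
    by (auto simp: basis_def independent_def)
  with I obtain X where X: "?P X" and max: "\<And>Y. ?P Y \<Longrightarrow> card Y \<le> card X"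
    using ex_has_greatest_nat[of ?P I card "Suc (card T)"] by blast
  have "g \<in> generated A X" if g: "g \<in> G" for g
  proof (rule ccontr)
    assume n: "g \<notin> generated A X"
    then have "?P (insert g X)"
      using X g G independent_insert by blast
    then have "card (insert g X) \<le> card X"
      using max by blast
    moreover have "g \<notin> X"
      using n generated_superset[of X] by blast
    ultimately show False
      using X finite_independent by auto
  qed
  then have "generated A G \<subseteq> generated A X"
    using X G by (subst generated_subset_iff) auto
  moreover have "generated A X \<subseteq> generated A G"
    using X by (simp add: generated_mono)
  ultimately have "basis A (generated A G) X"
    using X by (simp add: basis_def)
  with X that show ?thesis by blast
qed

text \<open>Only the added part \<open>Y\<close> is named, disjoint from \<open>I\<close>: this is
  the shape in which \<open>strong\<close> takes its bases.\<close>

lemma independent_extend_basis: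
  assumes "independent A I" "I \<subseteq> B" "subalgebra A B"
  obtains Y where "I \<inter> Y = {}" "basis A B (I \<union> Y)"
proof -
  obtain X where X: "I \<subseteq> X" "basis A (generated A B) X"
    using ex_basis_between[OF assms(1,2) subalgebra_subset[OF assms(3)]] by metis
  then have "I \<union> (X - I) = X" by blast
  with X(2) show ?thesis
    using that[of "X - I"] generated_subalgebra_eq[OF assms(3)] by simp
qed

lemma ex_basis:
  assumes "subalgebra A B"
  obtains X where "basis A B X"
  using independent_extend_basis[of "{}" B] assms by (auto simp: independent_def)

lemma basis_subset: "basis A B X \<Longrightarrow> X \<subseteq> B"
  using generated_superset[of X] by (auto simp: basis_def)

lemma dimension_generated_le:
  assumes "G \<subseteq> carrier A" "finite G"
  shows "dimension A (generated A G) \<le> card G"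
proof -
  obtain X where "X \<subseteq> G" "basis A (generated A G) X"
    using ex_basis_between[of "{}" G] assms by (auto simp: independent_def)
  then show ?thesis
    using dimension_eq assms(2) by (simp add: card_mono)
qed

lemma card_independent_le_dim:
  assumes "independent A I"
  shows "card I \<le> dimension A (carrier A)"
proof -
  have "I \<subseteq> carrier A"
    using assms by (simp add: independent_def)
  then obtain Y where "basis A (carrier A) (I \<union> Y)"
    using independent_extend_basis[OF assms _ subalgebra_carrier] by blast
  moreover from this have "finite (I \<union> Y)"
    using finite_independent[of "I \<union> Y"] by (simp add: basis_def)
  ultimately show ?thesis
    by (simp add: dimension_eq card_mono)
qed

text \<open>Constructs a left inverse of \<open>b\<close>. The images of \<open>X\<close> are
  completed to a basis of the whole algebra, because \<open>extension\<close> speaks of such bases;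
  an endomorphism sending these images back to \<open>X\<close> then undoes \<open>b\<close> on
  \<open>X\<close>, hence on all of \<open>dom b\<close>.\<close>

lemma partial_endo_inj_on:
  assumes b: "partial_endo A b" and X: "basis A (dom b) X"
    and inj: "inj_on (the \<circ> b) X" and ind: "independent A ((the \<circ> b) ` X)"
  shows "inj_on b (dom b)"
proof -
  let ?T = "(the \<circ> b) ` X"
  have Xd: "X \<subseteq> dom b" using X basis_subset by blast
  have XA: "X \<subseteq> carrier A" using X by (simp add: basis_def independent_def)
  have "?T \<subseteq> carrier A"
    using ind by (simp add: independent_def)
  then obtain S where S: "?T \<inter> S = {}" "basis A (carrier A) (?T \<union> S)"
    using independent_extend_basis[OF ind _ subalgebra_carrier] by blast
  \<comment> \<open>Off \<open>?T\<close> the identity is a default value; it only has to stay in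
    the carrier.\<close>
  define g where "g t = (if t \<in> ?T then inv_into X (the \<circ> b) t else t)" for t
  have "g \<in> ?T \<union> S \<rightarrow> carrier A"
  proof
    fix t
    assume t: "t \<in> ?T \<union> S"
    show "g t \<in> carrier A"
    proof (cases "t \<in> ?T")
      case True
      with inv_into_into[OF True] XA show ?thesis
        by (simp only: g_def if_True) blast
    next
      case False
      with t S(2) show ?thesis
        by (simp only: g_def if_False) (auto simp: basis_def independent_def)
    qed
  qed
  then obtain h where h: "h \<in> End A" "\<forall>x\<in>?T \<union> S. h x = Some (g x)"
    using extension[OF S(2)] by blast
  have hb: "partial_endo A (h \<circ>\<^sub>m b)"
    using h(1) b by (intro partial_endo_comp) (auto simp: End_def PEnd_def)
  have "(Some |` carrier A) x = (h \<circ>\<^sub>m b) x" if "x \<in> X" for x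
  proof -
    have "(the \<circ> b) x \<in> ?T" using that by blast
    then have "h ((the \<circ> b) x) = Some x"
      using h(2) that inv_into_f_f[OF inj that] by (simp add: g_def)
    moreover obtain y where "b x = Some y" using \<open>x \<in> X\<close> Xd by blast
    ultimately show ?thesis
      using that XA by (auto simp: map_comp_def)
  qed
  then have "(Some |` carrier A) x = (h \<circ>\<^sub>m b) x" if "x \<in> dom b" for x
    using that X XA partial_endos_agree[OF partial_endo_id hb, of X x] by (auto simp: basis_def)
  moreover have "dom b \<subseteq> carrier A"
    using b partial_endo_dom subalgebra_subset by blast
  ultimately have "(h \<circ>\<^sub>m b) x = Some x" if "x \<in> dom b" for x
    using that by (metis restrict_in subsetD)
  then show ?thesis
    by (intro inj_onI) (metis map_comp_def option.inject)
qed

end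

section \<open>The twisting and its vanishing\<close>

text \<open>This is the nonnegativity of the twisting, with the subtracted terms moved across so
  that it can be stated in the natural numbers.\<close>

lemma (in strong_independence_algebra) rank_sum_le:
  assumes fd: "finite_dimensional A"
    and a: "partial_endo A a" and b: "partial_endo A b"
  shows "rank A a + rank A b \<le> dimension A (carrier A) + rank A (b \<circ>\<^sub>m a)"
proof -
  interpret finite_dimensional_independence_algebra A
    using fd by unfold_locales
  let ?B = "ran a" and ?D = "dom b"
  have sB: "subalgebra A ?B" and sD: "subalgebra A ?D"
    using a b by (simp_all add: subalgebra_ran partial_endo_dom)
  obtain X where X: "basis A (?B \<inter> ?D) X"
    using ex_basis[OF subalgebra_Int[OF sB sD]] .
  have Xi: "independent A X" "X \<subseteq> ?B" "X \<subseteq> ?D"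
    using X basis_subset by (auto simp: basis_def)
  obtain Y where Y: "X \<inter> Y = {}" "basis A ?B (X \<union> Y)"
    using independent_extend_basis[OF Xi(1,2) sB] .
  obtain Z where Z: "X \<inter> Z = {}" "basis A ?D (X \<union> Z)"
    using independent_extend_basis[OF Xi(1,3) sD] .
  have ind: "independent A (X \<union> Y \<union> Z)"
    using strong[OF sB sD X Y Z] by (simp add: basis_def)
  then have fin: "finite X" "finite Y" "finite Z"
    using finite_independent[of "X \<union> Y \<union> Z"] by auto
  \<comment> \<open>A common element would lie in both \<open>?B\<close> and \<open>?D\<close>,
    hence in the closure of \<open>X\<close>.\<close>
  have "Y \<inter> Z = {}"
  proof (rule independent_Un_generated)
    show "independent A (X \<union> Y \<inter> Z)"
      using ind by (rule independent_subset) blast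
    show "Y \<inter> Z \<subseteq> generated A X"
      using X basis_subset[OF Y(2)] basis_subset[OF Z(2)] by (auto simp: basis_def)
  qed (use Y(1) in blast)
  with Y(1) Z(1) fin have "card (X \<union> Y \<union> Z) = card X + card Y + card Z"
    by (simp add: card_Un_disjoint Int_Un_distrib2)
  with card_independent_le_dim[OF ind]
  have le: "card X + card Y + card Z \<le> dimension A (carrier A)" by simp
  have ra: "rank A a = card X + card Y"
    unfolding rank_def using dimension_eq[OF Y(2)] Y(1) fin by (simp add: card_Un_disjoint)
  have Zd: "Z \<subseteq> ?D" using Z(2) basis_subset by blast
  have bXA: "(the \<circ> b) ` X \<subseteq> carrier A" and bZA: "(the \<circ> b) ` Z \<subseteq> carrier A"
    using partial_endo_image_subset[OF b] Xi(3) Zd by blast+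
  \<comment> \<open>Since \<open>b\<close> may collapse \<open>X\<close>, its image need not be
    independent; \<open>X1\<close> is a basis of the image of the product, chosen inside it.\<close>
  obtain X1 where X1: "X1 \<subseteq> (the \<circ> b) ` X" "basis A (generated A ((the \<circ> b) ` X)) X1"
    using ex_basis_between[of "{}" "(the \<circ> b) ` X"] bXA by (auto simp: independent_def)
  have "generated A X = ?B \<inter> ?D"
    using X by (simp add: basis_def)
  then have "ran (b \<circ>\<^sub>m a) = generated A ((the \<circ> b) ` X)"
    using image_generated[OF b Xi(3)] ran_map_comp[of b a] by simp
  then have rab: "rank A (b \<circ>\<^sub>m a) = card X1"
    using dimension_eq[OF X1(2)] by (simp add: rank_def)
  have "ran b = generated A ((the \<circ> b) ` X \<union> (the \<circ> b) ` Z)"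
    using Z(2) image_generated[OF b, of "X \<union> Z"] Xi(3) Zd
    by (simp add: ran_eq_image basis_def image_Un)
  also have "\<dots> = generated A (X1 \<union> (the \<circ> b) ` Z)"
    using X1 bXA bZA by (intro generated_Un_cong) (auto simp: basis_def)
  finally have "rank A b \<le> card (X1 \<union> (the \<circ> b) ` Z)"
    unfolding rank_def using X1 bXA bZA fin dimension_generated_le[of "X1 \<union> (the \<circ> b) ` Z"]
    by (metis Un_subset_iff finite_UnI finite_imageI finite_subset subset_trans)
  also have "\<dots> \<le> card X1 + card Z"
    using card_Un_le[of X1] card_image_le[OF fin(3), of "the \<circ> b"] by (meson add_left_mono order_trans)
  finally show ?thesis
    using le ra rab by simp
qed

text \<open>The rank equation says that the twisting vanishes at \<open>a\<close> and
  \<open>c\<close>; the two implications let the same \<open>c\<close> serve for \<open>End\<close>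
  and \<open>PAut\<close>.\<close>

lemma (in finite_dimensional_independence_algebra) ex_complementary_factor:
  assumes a: "partial_endo A a" and b: "partial_endo A b"
  obtains c where "partial_endo A c" "c \<circ>\<^sub>m a = b \<circ>\<^sub>m a"
    "rank A a + rank A c = dimension A (carrier A) + rank A (b \<circ>\<^sub>m a)"
    "dom b = carrier A \<Longrightarrow> dom c = carrier A"
    "inj_on b (dom b) \<Longrightarrow> inj_on c (dom c)"
proof -
  let ?B = "ran a" and ?D = "dom b" and ?bX = "\<lambda>X. (the \<circ> b) ` X"
  have sB: "subalgebra A ?B" and sD: "subalgebra A ?D"
    using a b by (simp_all add: subalgebra_ran partial_endo_dom)
  obtain X where X: "basis A (?B \<inter> ?D) X"
    using ex_basis[OF subalgebra_Int[OF sB sD]] .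
  have Xi: "independent A X" "X \<subseteq> ?B" "X \<subseteq> ?D"
    using X basis_subset by (auto simp: basis_def)
  have gX: "generated A X = ?B \<inter> ?D"
    using X by (simp add: basis_def)
  obtain Y where Y: "X \<inter> Y = {}" "basis A ?B (X \<union> Y)"
    using independent_extend_basis[OF Xi(1,2) sB] .
  have "independent A (X \<union> Y)" "X \<union> Y \<subseteq> carrier A"
    using Y(2) by (auto simp: basis_def independent_def)
  then obtain V where V: "(X \<union> Y) \<inter> V = {}" "basis A (carrier A) (X \<union> Y \<union> V)"
    using independent_extend_basis[OF _ _ subalgebra_carrier] by metis
  have ind: "independent A (X \<union> Y \<union> V)"
    using V(2) by (simp add: basis_def)
  then have fin: "finite X" "finite Y" "finite V" and XVA: "X \<union> Y \<union> V \<subseteq> carrier A"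
    using finite_independent[OF ind] ind by (auto simp: independent_def)
  have n: "dimension A (carrier A) = card X + card Y + card V"
    using dimension_eq[OF V(2)] V(1) Y(1) fin by (simp add: card_Un_disjoint)
  have bXA: "?bX X \<subseteq> carrier A"
    using partial_endo_image_subset[OF b Xi(3)] .
  obtain X1 where X1: "X1 \<subseteq> ?bX X" "basis A (generated A (?bX X)) X1"
    using ex_basis_between[of "{}" "?bX X"] bXA by (auto simp: independent_def)
  have X1i: "independent A X1" "X1 \<subseteq> carrier A" "finite X1"
    using X1 bXA finite_independent[of X1] by (auto simp: basis_def)
  \<comment> \<open>\<open>S\<close> supplies the targets for \<open>V\<close>, independent over the
    image of the product \<open>ab\<close>.\<close>
  obtain S where S: "X1 \<inter> S = {}" "basis A (carrier A) (X1 \<union> S)"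
    using independent_extend_basis[OF X1i(1,2) subalgebra_carrier] .
  have Si: "independent A (X1 \<union> S)" "finite S" "S \<subseteq> carrier A"
    using S(2) finite_independent[of "X1 \<union> S"] by (auto simp: basis_def independent_def)
  \<comment> \<open>Both \<open>card X1 + card S\<close> and \<open>card X + card Y + card V\<close>
    equal the dimension, so this inequality leaves room in \<open>S\<close> for an injective copy of
    \<open>V\<close>.\<close>
  have "card X1 \<le> card X"
    using X1(1) fin(1) by (meson card_image_le card_mono finite_imageI order_trans)
  moreover have "dimension A (carrier A) = card X1 + card S"
    using dimension_eq[OF S(2)] S(1) X1i(3) Si(2) by (simp add: card_Un_disjoint)
  ultimately have "card V \<le> card S"
    using n by simp
  then obtain u where u: "u ` V \<subseteq> S" "inj_on u V"
    using card_le_inj[OF fin(3) Si(2)] by blast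
  \<comment> \<open>On \<open>Y\<close> the identity is a default value: \<open>c\<close> will be
    restricted to the closure of \<open>X \<union> V\<close>.\<close>
  define g where "g x = (if x \<in> X then the (b x) else if x \<in> V then u x else x)" for x
  have "g \<in> X \<union> Y \<union> V \<rightarrow> carrier A"
    using bXA u(1) Si(3) XVA by (auto simp: g_def image_subset_iff subset_iff)
  then obtain h where h: "h \<in> End A" "\<forall>x\<in>X \<union> Y \<union> V. h x = Some (g x)"
    using extension[OF V(2)] by blast
  have hp: "partial_endo A h" "dom h = carrier A"
    using h(1) by (auto simp: End_def PEnd_def)
  define c where "c = h |` generated A (X \<union> V)"
  have sXV: "subalgebra A (generated A (X \<union> V))"
    using XVA by (intro subalgebra_generated) auto
  have cp: "partial_endo A c"
    unfolding c_def using hp sXV by (intro partial_endo_restrict) (auto dest: subalgebra_subset)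
  have dc: "dom c = generated A (X \<union> V)"
    unfolding c_def using hp sXV by (auto dest: subalgebra_subset)
  have XVd: "X \<union> V \<subseteq> dom c"
    using dc generated_superset[of "X \<union> V"] by simp
  have cg: "c x = Some (g x)" if "x \<in> X \<union> V" for x
  proof -
    have "x \<in> generated A (X \<union> V)"
      using XVd dc that by blast
    then show ?thesis
      using h(2) that by (auto simp: c_def)
  qed
  have cX: "c x = b x" if "x \<in> X" for x
  proof -
    obtain y where "b x = Some y"
      using \<open>x \<in> X\<close> Xi(3) by blast
    then show ?thesis
      using cg[of x] that by (simp add: g_def)
  qed
  have cV: "c x = Some (u x)" if "x \<in> V" for x
  proof -
    have "x \<notin> X"
      using V(1) that by blast
    then show ?thesis
      using cg[of x] that by (simp add: g_def)
  qed
  have c_image: "(the \<circ> c) ` (X \<union> V) = ?bX X \<union> u ` V"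
    using cX cV by (auto simp: image_Un image_iff)
  have agree: "c y = b y" if "y \<in> ?B \<inter> ?D" for y
    using that gX XVd cX partial_endos_agree[OF cp b, of X y] by auto
  \<comment> \<open>The left side is \<open>?B \<inter> dom c\<close>, so \<open>c\<close> and
    \<open>b\<close> are defined at the same points of the image of \<open>a\<close>.\<close>
  have "generated A (X \<union> Y) \<inter> generated A (X \<union> V) = generated A X"
    using ind fin(2) Y(1) V(1) by (intro generated_Int_independent) auto
  then have Bdc: "?B \<inter> dom c = ?B \<inter> ?D"
    using Y(2) gX dc by (simp add: basis_def)
  have ca: "c \<circ>\<^sub>m a = b \<circ>\<^sub>m a"
  proof
    fix x
    show "(c \<circ>\<^sub>m a) x = (b \<circ>\<^sub>m a) x"
    proof (cases "a x")
      case (Some y)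
      then have "y \<in> ?B" by (auto simp: ran_def)
      \<comment> \<open>Inside \<open>?D\<close> the maps agree on the closure of \<open>X\<close>;
        outside it both are undefined at \<open>y\<close>.\<close>
      then have "c y = b y"
        using agree[of y] Bdc by (cases "y \<in> ?D") (auto simp: domIff)
      then show ?thesis using Some by (simp add: map_comp_def)
    qed (simp add: map_comp_def)
  qed
  have ind1: "independent A (X1 \<union> u ` V)"
    using Si(1) u(1) by (auto intro: independent_subset)
  have "ran c = generated A (?bX X \<union> u ` V)"
    using image_generated[OF cp XVd] dc c_image by (simp add: ran_eq_image)
  also have "\<dots> = generated A (X1 \<union> u ` V)"
    using X1 X1i(2) bXA u(1) Si(3) by (intro generated_Un_cong) (auto simp: basis_def)
  finally have "basis A (ran c) (X1 \<union> u ` V)"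
    using ind1 by (simp add: basis_def)
  moreover have "X1 \<inter> u ` V = {}"
    using S(1) u(1) by blast
  ultimately have rc: "rank A c = card X1 + card V"
    using X1i(3) fin(3) u(2) by (simp add: rank_def dimension_eq card_Un_disjoint card_image)
  have ra: "rank A a = card X + card Y"
    unfolding rank_def using dimension_eq[OF Y(2)] Y(1) fin by (simp add: card_Un_disjoint)
  have "ran (b \<circ>\<^sub>m a) = generated A (?bX X)"
    using image_generated[OF b Xi(3)] ran_map_comp[of b a] gX by simp
  then have rab: "rank A (b \<circ>\<^sub>m a) = card X1"
    using dimension_eq[OF X1(2)] by (simp add: rank_def)
  show ?thesis
  proof (rule that[OF cp ca])
    show "rank A a + rank A c = dimension A (carrier A) + rank A (b \<circ>\<^sub>m a)"
      using ra rc rab n by simp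
  next
    \<comment> \<open>Now \<open>?B \<inter> ?D\<close> is all of \<open>?B\<close>, so
      \<open>X\<close> already generates the image of \<open>a\<close> and
      \<open>X \<union> V\<close> is a basis of the algebra.\<close>
    assume "dom b = carrier A"
    then have "Y \<subseteq> generated A X"
      using gX basis_subset[OF Y(2)] subalgebra_subset[OF sB] by auto
    moreover have "independent A (X \<union> Y)"
      using Y(2) by (simp add: basis_def)
    ultimately have "Y = {}"
      using independent_Un_generated Y(1) by blast
    then show "dom c = carrier A"
      using V(2) dc by (simp add: basis_def)
  next
    assume "inj_on b (dom b)"
    then have inj: "inj_on (the \<circ> b) (dom b)"
      by (simp add: inj_on_the)
    \<comment> \<open>The image of \<open>X\<close> is now independent, so its generating subset
      \<open>X1\<close> must be all of it.\<close>
    have "independent A (X1 \<union> (?bX X - X1))"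
      using independent_image[OF b inj Xi(1,3)] X1(1) by (simp add: Un_absorb1)
    moreover have "?bX X - X1 \<subseteq> generated A X1"
      using X1(2) generated_superset[of "?bX X"] by (auto simp: basis_def)
    ultimately have "?bX X - X1 = {}"
      using independent_Un_generated by blast
    then have X1_eq: "X1 = ?bX X"
      using X1(1) by blast
    \<comment> \<open>\<open>c\<close> is injective on \<open>X\<close> through \<open>b\<close> and
      on \<open>V\<close> through \<open>u\<close>, and the two images are separated by the
      disjointness of \<open>X1\<close> and \<open>S\<close>.\<close>
    have "inj_on (the \<circ> c) (X \<union> V)"
    proof (rule inj_on_Un[THEN iffD2], intro conjI)
      have "inj_on (the \<circ> b) X"
        using inj Xi(3) inj_on_subset by blast
      then show "inj_on (the \<circ> c) X"
        using cX by (simp add: inj_on_def)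
      show "inj_on (the \<circ> c) V"
        using u(2) cV by (simp add: inj_on_def)
      have "(the \<circ> c) ` X = X1" "(the \<circ> c) ` V = u ` V"
        unfolding X1_eq using cX cV by (auto simp: image_iff)
      then show "(the \<circ> c) ` (X - V) \<inter> (the \<circ> c) ` (V - X) = {}"
        using S(1) u(1) by blast
    qed
    moreover have "basis A (dom c) (X \<union> V)"
      using dc independent_subset[OF ind, of "X \<union> V"] by (auto simp: basis_def)
    moreover have "independent A ((the \<circ> c) ` (X \<union> V))"
      unfolding c_image using ind1 X1_eq by simp
    ultimately show "inj_on c (dom c)"
      using partial_endo_inj_on[OF cp] by blast
  qed
qed

theorem theorem4p8:
  fixes A :: "('a, 'f) ualgebra" and n :: nat
    and \<Phi> :: "('a \<rightharpoonup> 'a) \<Rightarrow> ('a \<rightharpoonup> 'a) \<Rightarrow> int"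
  assumes "strong_independence_algebra A"
    and "finite_dimensional A"
    and "dimension A (carrier A) = n"
    and \<Phi>: "\<And>a b. \<Phi> a b = int n - int (rank A a) - int (rank A b)
                          + int (rank A (a \<otimes>\<^bsub>PEnd A\<^esub> b))"
  shows "twisting (PEnd A) \<Phi>
    \<and> (\<forall>a\<in>carrier (PEnd A). \<forall>b\<in>carrier (PEnd A). \<exists>b'\<in>carrier (PEnd A).
           a \<otimes>\<^bsub>PEnd A\<^esub> b = a \<otimes>\<^bsub>PEnd A\<^esub> b' \<and> \<Phi> a b' = 0)
    \<and> (\<forall>a\<in>carrier (PEnd A). \<forall>b\<in>End A. \<exists>b'\<in>End A.
           a \<otimes>\<^bsub>PEnd A\<^esub> b = a \<otimes>\<^bsub>PEnd A\<^esub> b' \<and> \<Phi> a b' = 0)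
    \<and> (\<forall>a\<in>carrier (PEnd A). \<forall>b\<in>PAut A. \<exists>b'\<in>PAut A.
           a \<otimes>\<^bsub>PEnd A\<^esub> b = a \<otimes>\<^bsub>PEnd A\<^esub> b' \<and> \<Phi> a b' = 0)"
proof -
  interpret strong_independence_algebra A by fact
  interpret finite_dimensional_independence_algebra A
    using assms(2) by unfold_locales
  have carr: "carrier (PEnd A) = {b. partial_endo A b}"
    and mult: "a \<otimes>\<^bsub>PEnd A\<^esub> b = b \<circ>\<^sub>m a" for a b
    by (simp_all add: PEnd_def)
  have "twisting (PEnd A) \<Phi>"
  proof (intro twisting.intro twisting_axioms.intro monoid_PEnd)
    fix a b
    assume "a \<in> carrier (PEnd A)" "b \<in> carrier (PEnd A)"
    then have "\<Phi> a b \<ge> 0"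
      using rank_sum_le[OF assms(2), of a b] assms(3) by (simp add: carr mult \<Phi>)
    then show "\<Phi> a b \<in> \<nat>"
      by (metis nat_0_le of_nat_in_Nats)
  next
    fix a b c
    assume "a \<in> carrier (PEnd A)" "b \<in> carrier (PEnd A)" "c \<in> carrier (PEnd A)"
    \<comment> \<open>The rank of the intermediate product cancels on each side; what remains is
      \<open>2n\<close> minus the ranks of \<open>a\<close>, \<open>b\<close>, \<open>c\<close> plus
      the rank of \<open>abc\<close>.\<close>
    then show "\<Phi> a b + \<Phi> (a \<otimes>\<^bsub>PEnd A\<^esub> b) c = \<Phi> a (b \<otimes>\<^bsub>PEnd A\<^esub> c) + \<Phi> b c"
      by (simp add: \<Phi> monoid.m_assoc[OF monoid_PEnd])
  qed
  \<comment> \<open>One witness carries both membership implications, so (ii) and both cases of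
    (iii) are read off from it.\<close>
  moreover have factor: "\<exists>b'\<in>carrier (PEnd A). a \<otimes>\<^bsub>PEnd A\<^esub> b = a \<otimes>\<^bsub>PEnd A\<^esub> b' \<and> \<Phi> a b' = 0
      \<and> (b \<in> End A \<longrightarrow> b' \<in> End A) \<and> (b \<in> PAut A \<longrightarrow> b' \<in> PAut A)"
    if "a \<in> carrier (PEnd A)" "b \<in> carrier (PEnd A)" for a b
  proof -
    have "partial_endo A a" "partial_endo A b"
      using that by (simp_all add: carr)
    then obtain c where c: "partial_endo A c" "c \<circ>\<^sub>m a = b \<circ>\<^sub>m a"
      "rank A a + rank A c = dimension A (carrier A) + rank A (b \<circ>\<^sub>m a)"
      "dom b = carrier A \<Longrightarrow> dom c = carrier A"
      "inj_on b (dom b) \<Longrightarrow> inj_on c (dom c)"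
      using ex_complementary_factor by metis
    have "\<Phi> a c = 0"
      using c(2,3) assms(3) by (simp add: \<Phi> mult)
    with c show ?thesis
      by (intro bexI[of _ c]) (auto simp: carr mult End_def PAut_def)
  qed
  moreover have "\<exists>b'\<in>End A. a \<otimes>\<^bsub>PEnd A\<^esub> b = a \<otimes>\<^bsub>PEnd A\<^esub> b' \<and> \<Phi> a b' = 0"
    if "a \<in> carrier (PEnd A)" "b \<in> End A" for a b
    using factor[of a b] that unfolding End_def by blast
  moreover have "\<exists>b'\<in>PAut A. a \<otimes>\<^bsub>PEnd A\<^esub> b = a \<otimes>\<^bsub>PEnd A\<^esub> b' \<and> \<Phi> a b' = 0"
    if "a \<in> carrier (PEnd A)" "b \<in> PAut A" for a b
    using factor[of a b] that unfolding PAut_def by blast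
  ultimately show ?thesis
    by blast
qed

end
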